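(* Let $\beta \in (0,1)$ and $\sigma > 0$ be fixed, and set $\varepsilon_n = n^{-\beta}$. Consider, as $n \to \infty$, the problem of testing, based on $X_1,\dots,X_n$, the null hypothesis $\mathcal{H}_0$ that $X_1,\dots,X_n$ are iid $\mathcal{N}(0,1)$ versus the alternative $\mathcal{H}_1$ that $X_1,\dots,X_n$ are iid from the mixture $(1-\varepsilon_n)\,\mathcal{N}(0,1) + \varepsilon_n\,\mathcal{N}(0,\sigma^2)$. If $\beta > 1/2$ and $$\sigma < \frac{1}{\sqrt{1-\beta}},$$ then the likelihood ratio test, and therefore any other test, is asymptotically powerless.
   Context: $\mathcal{N}(0,s^2)$ denotes the centered Gaussian distribution on $\mathbb{R}$ with variance $s^2$. The asymptotic regime is $n \to \infty$, and only $n$ large enough that $\varepsilon_n < 1/2$ is considered. The test procedures are allowed to depend on $n$, $\varepsilon_n$ and $\sigma$. The likelihood ratio test is the test of the simple hypothesis $\mathcal{H}_0$ versus the simple hypothesis $\mathcal{H}_1$ based on the likelihood ratio of the sample $(X_1,\dots,X_n)$; its risk is the smallest possible, namely $1 - \frac12 \mathbb{E}_0|L-1|$, where $L$ is the likelihood ratio and $\mathbb{E}_0$ is expectation under $\mathcal{H}_0$. The risk of a test is the sum of its probabilities of Type I error (rejecting under $\mathcal{H}_0$) and Type II error (not rejecting under $\mathcal{H}_1$). A testing procedure (a sequence of tests indexed by $n$) is asymptotically powerless if the limit inferior of its risk as $n\to\infty$ is at least $1$. *)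

theory Defs
  imports "HOL-Probability.Probability"
begin

(* normal_density \<mu> s takes the standard deviation s, so its variance is s^2. *)

definition mixture_density :: "real \<Rightarrow> real \<Rightarrow> real \<Rightarrow> real" where
  "mixture_density \<epsilon> \<sigma> x = (1 - \<epsilon>) * normal_density 0 1 x + \<epsilon> * normal_density 0 \<sigma> x"

definition null_law :: "nat \<Rightarrow> (nat \<Rightarrow> real) measure" where
  "null_law n = (\<Pi>\<^sub>M i\<in>{1..n}. density lborel (\<lambda>x. ennreal (normal_density 0 1 x)))"

definition alt_law :: "nat \<Rightarrow> real \<Rightarrow> real \<Rightarrow> (nat \<Rightarrow> real) measure" where
  "alt_law n \<epsilon> \<sigma> = (\<Pi>\<^sub>M i\<in>{1..n}. density lborel (\<lambda>x. ennreal (mixture_density \<epsilon> \<sigma> x)))"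

(* Tests may be randomized: the value at x is the probability of rejecting the null hypothesis
   when x is observed. A test with rejection region R is the indicator function of R. *)

definition is_test :: "nat \<Rightarrow> ((nat \<Rightarrow> real) \<Rightarrow> real) \<Rightarrow> bool" where
  "is_test n \<phi> \<longleftrightarrow> \<phi> \<in> borel_measurable (\<Pi>\<^sub>M i\<in>{1..n}. borel) \<and>
     (\<forall>x \<in> space (\<Pi>\<^sub>M i\<in>{1..n}. borel :: real measure). 0 \<le> \<phi> x \<and> \<phi> x \<le> 1)"

definition type_I_error :: "nat \<Rightarrow> ((nat \<Rightarrow> real) \<Rightarrow> real) \<Rightarrow> real" where
  "type_I_error n \<phi> = (\<integral>x. \<phi> x \<partial>null_law n)"

definition type_II_error :: "nat \<Rightarrow> real \<Rightarrow> real \<Rightarrow> ((nat \<Rightarrow> real) \<Rightarrow> real) \<Rightarrow> real" where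
  "type_II_error n \<epsilon> \<sigma> \<phi> = (\<integral>x. 1 - \<phi> x \<partial>alt_law n \<epsilon> \<sigma>)"

definition risk :: "nat \<Rightarrow> real \<Rightarrow> real \<Rightarrow> ((nat \<Rightarrow> real) \<Rightarrow> real) \<Rightarrow> real" where
  "risk n \<epsilon> \<sigma> \<phi> = type_I_error n \<phi> + type_II_error n \<epsilon> \<sigma> \<phi>"

definition likelihood_ratio :: "nat \<Rightarrow> real \<Rightarrow> real \<Rightarrow> (nat \<Rightarrow> real) \<Rightarrow> real" where
  "likelihood_ratio n \<epsilon> \<sigma> x = (\<Prod>i\<in>{1..n}. mixture_density \<epsilon> \<sigma> (x i) / normal_density 0 1 (x i))"

(* The threshold 1 is the one that minimizes the sum of the two error probabilities, giving the
   risk 1 - E_0|L - 1| / 2; how ties L = 1 are broken does not affect the risk. *)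

definition lr_test :: "nat \<Rightarrow> real \<Rightarrow> real \<Rightarrow> (nat \<Rightarrow> real) \<Rightarrow> real" where
  "lr_test n \<epsilon> \<sigma> = indicator {x. likelihood_ratio n \<epsilon> \<sigma> x > 1}"

definition asymptotically_powerless ::
  "(nat \<Rightarrow> real) \<Rightarrow> real \<Rightarrow> (nat \<Rightarrow> (nat \<Rightarrow> real) \<Rightarrow> real) \<Rightarrow> bool" where
  "asymptotically_powerless \<epsilon> \<sigma> \<phi> \<longleftrightarrow> liminf (\<lambda>n. ereal (risk n (\<epsilon> n) \<sigma> (\<phi> n))) \<ge> 1"

lemma emeasure_mixture:
  assumes "0 \<le> \<epsilon>" "\<epsilon> \<le> 1" "A \<in> sets borel"
  shows "emeasure (density lborel (\<lambda>x. ennreal (mixture_density \<epsilon> \<sigma> x))) A =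
    ennreal (1 - \<epsilon>) * emeasure (density lborel (\<lambda>x. ennreal (normal_density 0 1 x))) A +
    ennreal \<epsilon> * emeasure (density lborel (\<lambda>x. ennreal (normal_density 0 \<sigma> x))) A"
proof -
  have "emeasure (density lborel (\<lambda>x. ennreal (mixture_density \<epsilon> \<sigma> x))) A =
    (\<integral>\<^sup>+x. ennreal (mixture_density \<epsilon> \<sigma> x) * indicator A x \<partial>lborel)"
    using assms by (subst emeasure_density) (auto simp: mixture_density_def[abs_def])
  also have "\<dots> = (\<integral>\<^sup>+x. ennreal (1 - \<epsilon>) * (ennreal (normal_density 0 1 x) * indicator A x) +
      ennreal \<epsilon> * (ennreal (normal_density 0 \<sigma> x) * indicator A x) \<partial>lborel)"
    using assms by (intro nn_integral_cong)
      (auto simp: mixture_density_def ennreal_plus ennreal_mult split: split_indicator)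
  also have "\<dots> = ennreal (1 - \<epsilon>) * (\<integral>\<^sup>+x. ennreal (normal_density 0 1 x) * indicator A x \<partial>lborel) +
      ennreal \<epsilon> * (\<integral>\<^sup>+x. ennreal (normal_density 0 \<sigma> x) * indicator A x \<partial>lborel)"
    using assms by (subst nn_integral_add) (auto simp: nn_integral_cmult)
  finally show ?thesis
    using assms by (simp add: emeasure_density)
qed

lemma prob_space_mixture:
  assumes "0 \<le> \<epsilon>" "\<epsilon> \<le> 1" "\<sigma> > 0"
  shows "prob_space (density lborel (\<lambda>x. ennreal (mixture_density \<epsilon> \<sigma> x)))"
proof
  have "emeasure (density lborel (\<lambda>x. ennreal (normal_density 0 s x))) UNIV = 1" if "s > 0" for s
    using prob_space.emeasure_space_1[OF prob_space_normal_density[OF that, of 0]] by simp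
  then show "emeasure (density lborel (\<lambda>x. ennreal (mixture_density \<epsilon> \<sigma> x)))
      (space (density lborel (\<lambda>x. ennreal (mixture_density \<epsilon> \<sigma> x)))) = 1"
    using assms by (simp add: emeasure_mixture ennreal_plus[symmetric] del: ennreal_plus)
qed

lemma risk_rejection_region:
  assumes "0 \<le> \<epsilon>" "\<epsilon> \<le> 1" "\<sigma> > 0" "R \<in> sets (\<Pi>\<^sub>M i\<in>{1..n}. borel :: real measure)"
  shows "risk n \<epsilon> \<sigma> (indicator R) =
    measure (null_law n) R + measure (alt_law n \<epsilon> \<sigma>) (space (alt_law n \<epsilon> \<sigma>) - R)"
proof -
  interpret alt: prob_space "alt_law n \<epsilon> \<sigma>"
    unfolding alt_law_def by (intro prob_space_PiM prob_space_mixture assms)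
  have sets: "sets (null_law n) = sets (\<Pi>\<^sub>M i\<in>{1..n}. borel)"
    "sets (alt_law n \<epsilon> \<sigma>) = sets (\<Pi>\<^sub>M i\<in>{1..n}. borel)"
    by (auto simp: null_law_def alt_law_def intro!: sets_PiM_cong)
  have "R \<subseteq> space (null_law n)"
    using assms sets by (metis sets.sets_into_space)
  then have "type_I_error n (indicator R) = measure (null_law n) R"
    by (simp add: type_I_error_def Int_absorb2)
  moreover have "type_II_error n \<epsilon> \<sigma> (indicator R) =
      measure (alt_law n \<epsilon> \<sigma>) (space (alt_law n \<epsilon> \<sigma>) - R)"
  proof -
    have "type_II_error n \<epsilon> \<sigma> (indicator R) =
        (\<integral>x. indicator (space (alt_law n \<epsilon> \<sigma>) - R) x \<partial>alt_law n \<epsilon> \<sigma>)"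
      unfolding type_II_error_def by (intro Bochner_Integration.integral_cong) (auto split: split_indicator)
    also have "\<dots> = measure (alt_law n \<epsilon> \<sigma>) ((space (alt_law n \<epsilon> \<sigma>) - R) \<inter> space (alt_law n \<epsilon> \<sigma>))"
      by simp
    also have "(space (alt_law n \<epsilon> \<sigma>) - R) \<inter> space (alt_law n \<epsilon> \<sigma>) = space (alt_law n \<epsilon> \<sigma>) - R"
      by auto
    finally show ?thesis .
  qed
  ultimately show ?thesis by (simp add: risk_def)
qed

end

theory Submission
  imports Defs
begin

text \<open>
  Write \<open>g\<close> for the standard normal density, \<open>f\<close> for the density of \<open>N(0, \<sigma>\<^sup>2)\<close>,
  \<open>l = 1 + \<epsilon> (f / g - 1)\<close> for the likelihood ratio of one observation and \<open>L\<close> for that of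
  the whole sample, the product of the \<open>l (x i)\<close>. All expectations are under the null hypothesis.

  The risk of a test \<open>\<phi>\<close> is \<open>E (\<phi> + (1 - \<phi>) L) = 1 + E ((1 - \<phi>) (L - 1))\<close>, so it is at least
  \<open>1 - E \<bar>L - 1\<bar>\<close> (\<open>risk_ge_total_variation\<close>), and it suffices that \<open>E \<bar>L - 1\<bar>\<close> tends to 0.
  The second moment of \<open>L\<close> would settle this for \<open>\<sigma>\<^sup>2 < 2\<close> only: from that value on \<open>f / g\<close> is not
  square integrable. The argument therefore uses the Hellinger affinity \<open>E (sqrt L)\<close>, which
  needs fewer moments and is still multiplicative over independent observations.

  A small \<open>1 - E (sqrt L)\<close> forces a small \<open>E \<bar>L - 1\<bar>\<close> (\<open>total_variation_le_affinity\<close>); by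
  independence and Bernoulli's inequality \<open>1 - E (sqrt L) \<le> n (1 - E (sqrt l))\<close>; and, for every
  exponent \<open>1 \<le> p \<le> 2\<close>,
  \<open>2 (1 - E (sqrt l)) = E ((sqrt l - 1)\<^sup>2) \<le> E (\<bar>l - 1\<bar> powr p) = \<epsilon> powr p * E (\<bar>f / g - 1\<bar> powr p)\<close>
  (\<open>one_minus_affinity_le_moment\<close>, \<open>mixture_ratio_moment\<close>). So \<open>1 - E (sqrt L)\<close> is at most a
  constant times \<open>n powr (1 - p \<beta>)\<close>, which tends to 0 when \<open>p > 1 / \<beta>\<close>. The constant is finite when
  \<open>p (1 - 1 / \<sigma>\<^sup>2) < 1\<close>, the condition for \<open>f powr p * g powr (1 - p)\<close> to be a multiple of a
  Gaussian density (\<open>integrable_gaussian_ratio_powr\<close>). A \<open>p\<close> satisfying both, and \<open>p \<le> 2\<close>,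
  exists exactly when \<open>\<beta> > 1 / 2\<close> and \<open>1 - 1 / \<sigma>\<^sup>2 < \<beta>\<close>; the latter is the hypothesis
  \<open>\<sigma> < 1 / sqrt (1 - \<beta>)\<close>.
\<close>

section \<open>Densities of product measures\<close>

text \<open>
  Both sides agree on boxes: there the indicator splits into a product over the coordinates, and
  Fubini's theorem turns the integral of the product into the product of the integrals.
\<close>

lemma (in prob_space) PiM_density_eq_density_prod:
  fixes l :: "'a \<Rightarrow> real"
  assumes I: "finite I" and l[measurable]: "l \<in> borel_measurable M" and nn: "\<And>x. 0 \<le> l x"
    and prob: "prob_space (density M (\<lambda>x. ennreal (l x)))"
  shows "(\<Pi>\<^sub>M i\<in>I. density M (\<lambda>x. ennreal (l x))) =
    density (\<Pi>\<^sub>M i\<in>I. M) (\<lambda>x. ennreal (\<Prod>i\<in>I. l (x i)))"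
proof -
  interpret P: product_prob_space "\<lambda>_. M" I
    by standard
  interpret Q: product_prob_space "\<lambda>_. density M (\<lambda>x. ennreal (l x))" I
    using prob by (intro product_prob_spaceI)
  have "density (\<Pi>\<^sub>M i\<in>I. M) (\<lambda>x. ennreal (\<Prod>i\<in>I. l (x i))) =
      (\<Pi>\<^sub>M i\<in>I. density M (\<lambda>x. ennreal (l x)))"
  proof (rule Q.PiM_eqI[OF I])
    show "sets (density (\<Pi>\<^sub>M i\<in>I. M) (\<lambda>x. ennreal (\<Prod>i\<in>I. l (x i)))) =
        sets (\<Pi>\<^sub>M i\<in>I. density M (\<lambda>x. ennreal (l x)))"
      by (auto intro!: sets_PiM_cong)
  next
    fix A assume A: "\<And>i. i \<in> I \<Longrightarrow> A i \<in> sets (density M (\<lambda>x. ennreal (l x)))"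
    then have A'[measurable]: "\<And>i. i \<in> I \<Longrightarrow> A i \<in> sets M" by simp
    have ind: "(indicator (Pi\<^sub>E I A) x :: ennreal) = (\<Prod>i\<in>I. indicator (A i) (x i))"
      if "x \<in> space (\<Pi>\<^sub>M i\<in>I. M)" for x
    proof (cases "x \<in> Pi\<^sub>E I A")
      case True
      then show ?thesis by (auto simp: indicator_def PiE_iff)
    next
      case False
      with that obtain i where "i \<in> I" "x i \<notin> A i"
        unfolding space_PiM PiE_iff by blast
      then have "(\<Prod>i\<in>I. indicator (A i) (x i) :: ennreal) = 0"
        using I by (intro prod_zero bexI[of _ i]) auto
      with False show ?thesis by simp
    qed
    have "emeasure (density (\<Pi>\<^sub>M i\<in>I. M) (\<lambda>x. ennreal (\<Prod>i\<in>I. l (x i)))) (Pi\<^sub>E I A) =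
        (\<integral>\<^sup>+x. ennreal (\<Prod>i\<in>I. l (x i)) * indicator (Pi\<^sub>E I A) x \<partial>(\<Pi>\<^sub>M i\<in>I. M))"
      using I A' by (intro emeasure_density sets_PiM_I_finite) auto
    also have "\<dots> = (\<integral>\<^sup>+x. (\<Prod>i\<in>I. ennreal (l (x i)) * indicator (A i) (x i)) \<partial>(\<Pi>\<^sub>M i\<in>I. M))"
      using nn by (intro nn_integral_cong) (simp add: ind prod.distrib prod_ennreal)
    also have "\<dots> = (\<Prod>i\<in>I. \<integral>\<^sup>+x. ennreal (l x) * indicator (A i) x \<partial>M)"
      using I A' by (intro P.product_nn_integral_prod) auto
    also have "\<dots> = (\<Prod>i\<in>I. emeasure (density M (\<lambda>x. ennreal (l x))) (A i))"
      using A' by (intro prod.cong) (auto simp: emeasure_density)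
    finally show "emeasure (density (\<Pi>\<^sub>M i\<in>I. M) (\<lambda>x. ennreal (\<Prod>i\<in>I. l (x i)))) (Pi\<^sub>E I A) =
        (\<Prod>i\<in>I. emeasure (density M (\<lambda>x. ennreal (l x))) (A i))" .
  qed
  then show ?thesis by simp
qed

section \<open>Total variation and Hellinger affinity\<close>

lemma integrable_sqrt:
  fixes L :: "'a \<Rightarrow> real"
  assumes "finite_measure M" "integrable M L" "\<And>x. 0 \<le> L x"
  shows "integrable M (\<lambda>x. sqrt (L x))"
proof -
  interpret finite_measure M by fact
  have "sqrt (L x) \<le> 1 + L x" for x
    using assms(3)[of x] by (intro real_le_lsqrt) (auto simp: power2_eq_square algebra_simps)
  then have "norm (sqrt (L x)) \<le> norm (1 + L x)" for x
    using assms(3)[of x] by simp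
  moreover have "integrable M (\<lambda>x. 1 + L x)"
    using assms(2) by simp
  moreover have "(\<lambda>x. sqrt (L x)) \<in> borel_measurable M"
    using borel_measurable_integrable[OF assms(2)] by measurable
  ultimately show ?thesis
    by (auto intro: Bochner_Integration.integrable_bound)
qed

lemma sqrt_prod: "sqrt (\<Prod>i\<in>I. f i) = (\<Prod>i\<in>I. sqrt (f i))"
  by (induction I rule: infinite_finite_induct) (simp_all add: real_sqrt_mult)

lemma abs_diff_one_eq_sqrt:
  fixes y :: real
  assumes "0 \<le> y"
  shows "\<bar>y - 1\<bar> = \<bar>sqrt y - 1\<bar> * (sqrt y + 1)"
proof -
  have "y - 1 = (sqrt y - 1) * (sqrt y + 1)"
    using assms by (simp add: algebra_simps)
  then have "\<bar>y - 1\<bar> = \<bar>sqrt y - 1\<bar> * \<bar>sqrt y + 1\<bar>"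
    by (simp only: abs_mult)
  then show ?thesis using assms by simp
qed

text \<open>
  The factorisation \<open>\<bar>L - 1\<bar> = \<bar>sqrt L - 1\<bar> (sqrt L + 1)\<close> asks for the Cauchy--Schwarz
  inequality; the free parameter \<open>c\<close> replaces it by the pointwise inequality
  \<open>2 a b \<le> a\<^sup>2 / c + c b\<^sup>2\<close>. Then \<open>E ((sqrt L - 1)\<^sup>2) = 2 (1 - E (sqrt L))\<close>, while
  \<open>E ((sqrt L + 1)\<^sup>2) \<le> 4\<close>.
\<close>

lemma (in prob_space) total_variation_le_affinity:
  fixes L :: "'a \<Rightarrow> real"
  assumes L: "integrable M L" "\<And>x. 0 \<le> L x" "(\<integral>x. L x \<partial>M) = 1" and c: "0 < c"
  shows "(\<integral>x. \<bar>L x - 1\<bar> \<partial>M) \<le> (1 - (\<integral>x. sqrt (L x) \<partial>M)) / c + 2 * c"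
proof -
  have iS: "integrable M (\<lambda>x. sqrt (L x))"
    using L by (intro integrable_sqrt finite_measure_axioms)
  have pw: "\<bar>L x - 1\<bar> \<le> (1 + L x - 2 * sqrt (L x)) / (2 * c) + c * (1 + L x + 2 * sqrt (L x)) / 2" for x
  proof -
    define s where "s = sqrt (L x)"
    have s: "0 \<le> s" "L x = s\<^sup>2" using L(2)[of x] by (auto simp: s_def)
    have eq: "\<bar>L x - 1\<bar> = \<bar>s - 1\<bar> * (s + 1)"
      unfolding s_def by (rule abs_diff_one_eq_sqrt[OF L(2)])
    have "0 \<le> (\<bar>s - 1\<bar> - c * (s + 1))\<^sup>2" by simp
    then have "2 * c * (\<bar>s - 1\<bar> * (s + 1)) \<le> (s - 1)\<^sup>2 + (c * (s + 1))\<^sup>2"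
      by (simp add: power2_diff algebra_simps)
    then have "\<bar>s - 1\<bar> * (s + 1) \<le> ((s - 1)\<^sup>2 + (c * (s + 1))\<^sup>2) / (2 * c)"
      using c by (simp add: field_simps)
    also have "\<dots> = (1 + L x - 2 * s) / (2 * c) + c * (1 + L x + 2 * s) / 2"
      using c by (simp add: s power2_eq_square field_simps)
    finally show ?thesis using eq by (simp add: s_def)
  qed
  have S1: "(\<integral>x. sqrt (L x) \<partial>M) \<le> 1"
  proof -
    have "(\<integral>x. sqrt (L x) \<partial>M) \<le> (\<integral>x. (1 + L x) / 2 \<partial>M)"
      using iS L arith_geo_mean_sqrt[of "1::real"] by (intro integral_mono) auto
    then show ?thesis using L by (simp add: prob_space)
  qed
  have "(\<integral>x. \<bar>L x - 1\<bar> \<partial>M) \<le>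
      (\<integral>x. (1 + L x - 2 * sqrt (L x)) / (2 * c) + c * (1 + L x + 2 * sqrt (L x)) / 2 \<partial>M)"
    using iS L pw by (intro integral_mono) auto
  also have "\<dots> = (1 - (\<integral>x. sqrt (L x) \<partial>M)) / c + c * (1 + (\<integral>x. sqrt (L x) \<partial>M))"
    using iS L c by (simp add: prob_space field_simps)
  also have "\<dots> \<le> (1 - (\<integral>x. sqrt (L x) \<partial>M)) / c + 2 * c"
    using S1 c by simp
  finally show ?thesis .
qed

text \<open>
  With \<open>t = \<bar>sqrt y - 1\<bar>\<close> and \<open>u = \<bar>y - 1\<bar>\<close>, the square of \<open>t\<close> is bounded by both \<open>u\<close> and
  \<open>u\<^sup>2\<close>, the first bound being good for large \<open>u\<close> and the second for small \<open>u\<close>; every exponent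
  between 1 and 2 interpolates.
\<close>

lemma sqrt_diff_one_squared_le_powr:
  fixes y p :: real
  assumes "0 \<le> y" "1 \<le> p" "p \<le> 2"
  shows "(sqrt y - 1)\<^sup>2 \<le> \<bar>y - 1\<bar> powr p"
proof -
  define u where "u = \<bar>y - 1\<bar>"
  define t where "t = \<bar>sqrt y - 1\<bar>"
  have "0 \<le> sqrt y" using assms(1) by simp
  then have t: "0 \<le> t" "t \<le> sqrt y + 1"
    unfolding t_def by linarith+
  have u: "u = t * (sqrt y + 1)"
    unfolding u_def t_def by (rule abs_diff_one_eq_sqrt[OF assms(1)])
  have tu: "t \<le> u" "t\<^sup>2 \<le> u"
    using mult_left_mono[of 1 "sqrt y + 1" t] mult_left_mono[OF t(2,1)] t(1) assms(1)
    by (simp_all add: u power2_eq_square)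
  have "t\<^sup>2 \<le> u powr p"
  proof (cases "u \<le> 1")
    case True
    have "t\<^sup>2 \<le> u\<^sup>2" using tu t by (intro power_mono) auto
    also have "\<dots> = u powr 2" using t tu by (cases "u = 0") (auto simp: powr_numeral)
    also have "\<dots> \<le> u powr p" using True t tu assms by (intro powr_mono') auto
    finally show ?thesis .
  next
    case False
    then have "u powr 1 \<le> u powr p" using assms by (intro powr_mono) auto
    with tu False show ?thesis by simp
  qed
  then show ?thesis by (simp add: t_def u_def)
qed

lemma (in prob_space) one_minus_affinity_le_moment:
  fixes l :: "'a \<Rightarrow> real"
  assumes l: "integrable M l" "\<And>x. 0 \<le> l x" "(\<integral>x. l x \<partial>M) = 1"
    and p: "1 \<le> p" "p \<le> 2" and m: "integrable M (\<lambda>x. \<bar>l x - 1\<bar> powr p)"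
  shows "1 - (\<integral>x. sqrt (l x) \<partial>M) \<le> (\<integral>x. \<bar>l x - 1\<bar> powr p \<partial>M) / 2"
proof -
  have iS: "integrable M (\<lambda>x. sqrt (l x))"
    using l by (intro integrable_sqrt finite_measure_axioms)
  have "2 * (1 - (\<integral>x. sqrt (l x) \<partial>M)) = (\<integral>x. 1 + l x - 2 * sqrt (l x) \<partial>M)"
    using iS l by (simp add: prob_space)
  also have "\<dots> \<le> (\<integral>x. \<bar>l x - 1\<bar> powr p \<partial>M)"
  proof (intro integral_mono)
    fix x
    have "1 + l x - 2 * sqrt (l x) = (sqrt (l x) - 1)\<^sup>2"
      using l(2)[of x] by (simp add: power2_diff)
    with sqrt_diff_one_squared_le_powr[OF l(2)[of x] p]
    show "1 + l x - 2 * sqrt (l x) \<le> \<bar>l x - 1\<bar> powr p" by simp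
  qed (use iS l m in auto)
  finally show ?thesis by simp
qed

text \<open>
  Independence enters here: the affinity of the product is the power \<open>(E (sqrt l)) ^ card I\<close>, and
  Bernoulli's inequality makes the loss linear in the sample size.
\<close>

lemma (in prob_space) total_variation_PiM_le:
  fixes l :: "'a \<Rightarrow> real" and c :: real
  assumes l: "integrable M l" "\<And>x. 0 \<le> l x" "(\<integral>x. l x \<partial>M) = 1"
    and p: "1 \<le> p" "p \<le> 2" and m: "integrable M (\<lambda>x. \<bar>l x - 1\<bar> powr p)"
    and I: "finite I" and c: "0 < c"
  shows "(\<integral>x. \<bar>(\<Prod>i\<in>I. l (x i)) - 1\<bar> \<partial>(\<Pi>\<^sub>M i\<in>I. M)) \<le>
    real (card I) * (\<integral>x. \<bar>l x - 1\<bar> powr p \<partial>M) / (2 * c) + 2 * c"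
proof -
  interpret P: product_prob_space "\<lambda>_. M" I
    by standard
  have prod_prob: "prob_space (\<Pi>\<^sub>M i\<in>I. M)"
    by (intro prob_space_PiM prob_space_axioms)
  define a where "a = (\<integral>x. sqrt (l x) \<partial>M)"
  define J where "J = (\<integral>x. \<bar>l x - 1\<bar> powr p \<partial>M)"
  have iS: "integrable M (\<lambda>x. sqrt (l x))"
    using l by (intro integrable_sqrt finite_measure_axioms)
  have a0: "0 \<le> a" using l by (simp add: a_def)
  have aJ: "1 - a \<le> J / 2"
    unfolding a_def J_def by (rule one_minus_affinity_le_moment[OF l p m])
  have "(\<integral>x. sqrt (\<Prod>i\<in>I. l (x i)) \<partial>(\<Pi>\<^sub>M i\<in>I. M)) = (\<integral>x. (\<Prod>i\<in>I. sqrt (l (x i))) \<partial>(\<Pi>\<^sub>M i\<in>I. M))"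
    by (simp add: sqrt_prod)
  also have "\<dots> = a ^ card I"
    by (subst P.product_integral_prod[OF I iS]) (simp add: a_def)
  finally have S: "(\<integral>x. sqrt (\<Prod>i\<in>I. l (x i)) \<partial>(\<Pi>\<^sub>M i\<in>I. M)) = a ^ card I" .
  have "1 + real (card I) * (a - 1) \<le> (1 + (a - 1)) ^ card I"
    using a0 by (intro Bernoulli_inequality) auto
  then have "1 - a ^ card I \<le> real (card I) * (1 - a)"
    by (simp add: algebra_simps)
  also have "\<dots> \<le> real (card I) * (J / 2)"
    using aJ by (intro mult_left_mono) auto
  finally have "(1 - a ^ card I) / c \<le> real (card I) * (J / 2) / c"
    using c by (intro divide_right_mono) auto
  moreover have "(\<integral>x. \<bar>(\<Prod>i\<in>I. l (x i)) - 1\<bar> \<partial>(\<Pi>\<^sub>M i\<in>I. M)) \<le> (1 - a ^ card I) / c + 2 * c"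
    unfolding S[symmetric]
  proof (rule prob_space.total_variation_le_affinity[OF prod_prob _ _ _ c])
    show "integrable (\<Pi>\<^sub>M i\<in>I. M) (\<lambda>x. \<Prod>i\<in>I. l (x i))"
      by (rule P.product_integrable_prod[OF I l(1)])
    show "0 \<le> (\<Prod>i\<in>I. l (x i))" for x
      by (intro prod_nonneg l)
    show "(\<integral>x. (\<Prod>i\<in>I. l (x i)) \<partial>(\<Pi>\<^sub>M i\<in>I. M)) = 1"
      by (subst P.product_integral_prod[OF I l(1)]) (simp add: l)
  qed
  ultimately show ?thesis unfolding J_def by simp
qed

section \<open>Risk and total variation\<close>

abbreviation mixture_ratio :: "real \<Rightarrow> real \<Rightarrow> real \<Rightarrow> real" where
  "mixture_ratio \<epsilon> \<sigma> x \<equiv> mixture_density \<epsilon> \<sigma> x / normal_density 0 1 x"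

lemma prob_space_std_normal: "prob_space std_normal_distribution"
  by (rule prob_space_normal_density) simp

lemma borel_measurable_mixture_density [measurable]: "mixture_density \<epsilon> \<sigma> \<in> borel_measurable borel"
  by (simp add: mixture_density_def[abs_def])

lemma mixture_density_nonneg: "0 \<le> \<epsilon> \<Longrightarrow> \<epsilon> \<le> 1 \<Longrightarrow> 0 \<le> mixture_density \<epsilon> \<sigma> x"
  by (simp add: mixture_density_def)

lemma mixture_ratio_nonneg: "0 \<le> \<epsilon> \<Longrightarrow> \<epsilon> \<le> 1 \<Longrightarrow> 0 \<le> mixture_ratio \<epsilon> \<sigma> x"
  by (simp add: mixture_density_nonneg)

lemma density_std_normal_mixture_ratio:
  assumes "0 \<le> \<epsilon>" "\<epsilon> \<le> 1"
  shows "density std_normal_distribution (\<lambda>x. ennreal (mixture_ratio \<epsilon> \<sigma> x)) =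
    density lborel (\<lambda>x. ennreal (mixture_density \<epsilon> \<sigma> x))"
proof -
  have "ennreal (normal_density 0 1 x) * ennreal (mixture_ratio \<epsilon> \<sigma> x) = ennreal (mixture_density \<epsilon> \<sigma> x)" for x
    using assms mixture_density_nonneg[OF assms, of \<sigma> x] normal_density_pos[of 1 0 x]
    by (simp add: ennreal_mult[symmetric])
  then show ?thesis
    by (subst density_density_eq) auto
qed

lemma mixture_ratio_mean_one:
  assumes "0 \<le> \<epsilon>" "\<epsilon> \<le> 1" "0 < \<sigma>"
  shows "integrable std_normal_distribution (mixture_ratio \<epsilon> \<sigma>)" "(\<integral>x. mixture_ratio \<epsilon> \<sigma> x \<partial>std_normal_distribution) = 1"
proof -
  have eq: "normal_density 0 1 x *\<^sub>R mixture_ratio \<epsilon> \<sigma> x = mixture_density \<epsilon> \<sigma> x" for x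
    using normal_density_pos[of 1 0 x] by simp
  have int: "integrable lborel (mixture_density \<epsilon> \<sigma>)" "(\<integral>x. mixture_density \<epsilon> \<sigma> x \<partial>lborel) = 1"
    using assms by (simp_all add: mixture_density_def[abs_def])
  show "integrable std_normal_distribution (mixture_ratio \<epsilon> \<sigma>)"
    by (subst integrable_density) (simp_all only: eq int, auto)
  show "(\<integral>x. mixture_ratio \<epsilon> \<sigma> x \<partial>std_normal_distribution) = 1"
    by (subst integral_density) (simp_all only: eq int, auto)
qed

lemma alt_law_eq_density:
  assumes "0 \<le> \<epsilon>" "\<epsilon> \<le> 1" "0 < \<sigma>"
  shows "alt_law n \<epsilon> \<sigma> = density (null_law n) (\<lambda>x. ennreal (likelihood_ratio n \<epsilon> \<sigma> x))"
proof -
  interpret prob_space std_normal_distribution by (rule prob_space_std_normal)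
  show ?thesis
    unfolding alt_law_def null_law_def likelihood_ratio_def
      density_std_normal_mixture_ratio[OF assms(1,2), symmetric]
    using assms
    by (intro PiM_density_eq_density_prod)
      (auto simp: mixture_density_nonneg density_std_normal_mixture_ratio prob_space_mixture)
qed

lemma is_test_lr_test: "is_test n (lr_test n \<epsilon> \<sigma>)"
proof -
  have "likelihood_ratio n \<epsilon> \<sigma> \<in> borel_measurable (\<Pi>\<^sub>M i\<in>{1..n}. borel)"
    unfolding likelihood_ratio_def[abs_def] by measurable
  then have "(\<lambda>x. if likelihood_ratio n \<epsilon> \<sigma> x > 1 then 1 else 0 :: real) \<in> borel_measurable (\<Pi>\<^sub>M i\<in>{1..n}. borel)"
    by measurable
  moreover have "lr_test n \<epsilon> \<sigma> = (\<lambda>x. if likelihood_ratio n \<epsilon> \<sigma> x > 1 then 1 else 0)"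
    by (auto simp: lr_test_def indicator_def fun_eq_iff)
  ultimately show ?thesis by (auto simp: is_test_def)
qed

text \<open>
  After the change of measure, the risk minus 1 is \<open>E ((1 - \<phi>) (L - 1))\<close>, and \<open>1 - \<phi>\<close> lies
  between 0 and 1. The optimal bound \<open>1 - E \<bar>L - 1\<bar> / 2\<close> is better by a factor that does not
  matter for the limit.
\<close>

lemma risk_ge_total_variation:
  assumes \<epsilon>: "0 \<le> \<epsilon>" "\<epsilon> \<le> 1" "0 < \<sigma>" and \<phi>: "is_test n \<phi>"
  shows "1 - (\<integral>x. \<bar>likelihood_ratio n \<epsilon> \<sigma> x - 1\<bar> \<partial>null_law n) \<le> risk n \<epsilon> \<sigma> \<phi>"
proof -
  interpret P: product_prob_space "\<lambda>_. std_normal_distribution" "{1..n}"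
    by (intro product_prob_spaceI prob_space_std_normal)
  interpret N: prob_space "null_law n"
    unfolding null_law_def by (intro prob_space_PiM prob_space_std_normal)
  let ?L = "likelihood_ratio n \<epsilon> \<sigma>"
  have sets: "sets (null_law n) = sets (\<Pi>\<^sub>M i\<in>{1..n}. borel)"
    unfolding null_law_def by (intro sets_PiM_cong) auto
  have sp: "space (null_law n) = space (\<Pi>\<^sub>M i\<in>{1..n}. borel)"
    by (rule sets_eq_imp_space_eq[OF sets])
  have meas[measurable]: "\<phi> \<in> borel_measurable (null_law n)"
    using \<phi> measurable_cong_sets[OF sets refl] by (auto simp: is_test_def)
  have b: "0 \<le> \<phi> x \<and> \<phi> x \<le> 1" if "x \<in> space (null_law n)" for x
    using \<phi> that by (auto simp: is_test_def sp)
  have L: "integrable (null_law n) ?L" and L0: "\<And>x. 0 \<le> ?L x"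
    using mixture_ratio_mean_one[OF \<epsilon>] \<epsilon> unfolding null_law_def likelihood_ratio_def[abs_def]
    by (auto intro!: P.product_integrable_prod prod_nonneg mixture_ratio_nonneg)
  have i\<phi>: "integrable (null_law n) \<phi>"
    using b by (intro N.integrable_const_bound[of _ 1]) auto
  have iL\<phi>: "integrable (null_law n) (\<lambda>x. ?L x * (1 - \<phi> x))"
    using L L0 b by (intro Bochner_Integration.integrable_bound[OF L])
      (auto intro!: AE_I2 mult_left_le simp: abs_mult)
  have II: "type_II_error n \<epsilon> \<sigma> \<phi> = (\<integral>x. ?L x * (1 - \<phi> x) \<partial>null_law n)"
    unfolding type_II_error_def alt_law_eq_density[OF \<epsilon>]
    using L L0 by (subst integral_density) auto
  have "1 - (\<integral>x. \<bar>?L x - 1\<bar> \<partial>null_law n) = (\<integral>x. 1 - \<bar>?L x - 1\<bar> \<partial>null_law n)"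
    using L by (simp add: N.prob_space)
  also have "\<dots> \<le> (\<integral>x. \<phi> x + ?L x * (1 - \<phi> x) \<partial>null_law n)"
  proof (intro integral_mono)
    fix x assume "x \<in> space (null_law n)"
    then have "\<bar>(1 - ?L x) * (1 - \<phi> x)\<bar> \<le> \<bar>?L x - 1\<bar>"
      using b by (auto intro!: mult_left_le simp: abs_mult abs_minus_commute)
    then have "(1 - ?L x) * (1 - \<phi> x) \<le> \<bar>?L x - 1\<bar>" by simp
    then show "1 - \<bar>?L x - 1\<bar> \<le> \<phi> x + ?L x * (1 - \<phi> x)"
      by (simp add: algebra_simps)
  qed (use L i\<phi> iL\<phi> in auto)
  also have "\<dots> = risk n \<epsilon> \<sigma> \<phi>"
    using i\<phi> iL\<phi> by (simp add: risk_def type_I_error_def II)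
  finally show ?thesis .
qed

section \<open>Moments of the Gaussian likelihood ratio\<close>

text \<open>
  The exponent of \<open>f powr p * g powr (1 - p)\<close> is \<open>- \<kappa> x\<^sup>2 / 2\<close> with
  \<open>\<kappa> = 1 - p (1 - 1 / \<sigma>\<^sup>2)\<close>, so for \<open>\<kappa> > 0\<close> this is a multiple of the centred Gaussian
  density of variance \<open>1 / \<kappa>\<close>.
\<close>

lemma integrable_gaussian_ratio_powr:
  fixes \<sigma> p :: real
  assumes \<sigma>: "0 < \<sigma>" and p: "p * (1 - 1 / \<sigma>\<^sup>2) < 1"
  shows "integrable std_normal_distribution (\<lambda>x. (normal_density 0 \<sigma> x / normal_density 0 1 x) powr p)"
proof -
  define \<kappa> where "\<kappa> = 1 - p * (1 - 1 / \<sigma>\<^sup>2)"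
  have \<kappa>: "0 < \<kappa>" using p by (simp add: \<kappa>_def)
  define s where "s = 1 / sqrt \<kappa>"
  have s: "0 < s" "s\<^sup>2 = 1 / \<kappa>" using \<kappa> by (auto simp: s_def power_divide)
  have eq: "normal_density 0 1 x * (normal_density 0 \<sigma> x / normal_density 0 1 x) powr p =
      (1 / \<sigma>) powr p * s * normal_density 0 s x" for x
  proof -
    have "normal_density 0 \<sigma> x / normal_density 0 1 x = exp (x\<^sup>2 / 2 - x\<^sup>2 / (2 * \<sigma>\<^sup>2)) / \<sigma>"
    proof -
      have "- x\<^sup>2 / (2 * \<sigma>\<^sup>2) = (x\<^sup>2 / 2 - x\<^sup>2 / (2 * \<sigma>\<^sup>2)) + - x\<^sup>2 / 2" by simp
      then have "exp (- x\<^sup>2 / (2 * \<sigma>\<^sup>2)) = exp (x\<^sup>2 / 2 - x\<^sup>2 / (2 * \<sigma>\<^sup>2)) * exp (- x\<^sup>2 / 2)"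
        by (simp only: exp_add)
      then show ?thesis using \<sigma> by (simp add: normal_density_def real_sqrt_mult)
    qed
    then have "(normal_density 0 \<sigma> x / normal_density 0 1 x) powr p =
        (1 / \<sigma>) powr p * exp (p * (x\<^sup>2 / 2 - x\<^sup>2 / (2 * \<sigma>\<^sup>2)))"
      using \<sigma> by (simp add: powr_divide exp_powr_real mult.commute)
    moreover have "normal_density 0 1 x = exp (- x\<^sup>2 / 2) / sqrt (2 * pi)"
      by (simp add: normal_density_def)
    moreover have "s * normal_density 0 s x = exp (- \<kappa> * x\<^sup>2 / 2) / sqrt (2 * pi)"
    proof -
      have "sqrt (2 * pi * s\<^sup>2) = sqrt (2 * pi) * s"
        using s(1) by (simp add: real_sqrt_mult)
      moreover have "- x\<^sup>2 / (2 * s\<^sup>2) = - \<kappa> * x\<^sup>2 / 2"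
        by (simp add: s(2))
      ultimately show ?thesis
        using s(1) by (simp add: normal_density_def)
    qed
    moreover have "exp (- x\<^sup>2 / 2) * exp (p * (x\<^sup>2 / 2 - x\<^sup>2 / (2 * \<sigma>\<^sup>2))) = exp (- \<kappa> * x\<^sup>2 / 2)"
      unfolding exp_add[symmetric] \<kappa>_def using \<sigma> by (intro arg_cong[of _ _ exp]) (simp add: field_simps)
    ultimately show ?thesis by (simp add: mult.assoc)
  qed
  show ?thesis
    using s by (subst integrable_density) (auto simp: eq)
qed

text \<open>
  Since \<open>l - 1 = \<epsilon> (f / g - 1)\<close>, the dependence on \<open>\<epsilon>\<close> is a factor \<open>\<epsilon> powr p\<close>. The
  constant \<open>C\<close> depends on \<open>\<sigma>\<close> and \<open>p\<close> alone, so that it stays fixed as the sample grows.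
\<close>

lemma mixture_ratio_moment:
  fixes \<sigma> p :: real
  assumes \<sigma>: "0 < \<sigma>" and p: "0 \<le> p" "p * (1 - 1 / \<sigma>\<^sup>2) < 1"
  obtains C where "\<And>\<epsilon>. 0 \<le> \<epsilon> \<Longrightarrow> integrable std_normal_distribution (\<lambda>x. \<bar>mixture_ratio \<epsilon> \<sigma> x - 1\<bar> powr p)"
    and "\<And>\<epsilon>. 0 \<le> \<epsilon> \<Longrightarrow> (\<integral>x. \<bar>mixture_ratio \<epsilon> \<sigma> x - 1\<bar> powr p \<partial>std_normal_distribution) = C * \<epsilon> powr p"
proof -
  interpret prob_space std_normal_distribution by (rule prob_space_std_normal)
  define r where "r x = normal_density 0 \<sigma> x / normal_density 0 1 x" for x
  have r0: "0 \<le> r x" for x by (simp add: r_def)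
  have r_meas [measurable]: "r \<in> borel_measurable borel"
    by (simp add: r_def[abs_def])
  have "integrable std_normal_distribution (\<lambda>x. 2 powr p * (r x powr p + 1))"
    using integrable_gaussian_ratio_powr[OF \<sigma> p(2)] by (auto simp: r_def)
  then have int: "integrable std_normal_distribution (\<lambda>x. \<bar>r x - 1\<bar> powr p)"
  proof (rule Bochner_Integration.integrable_bound)
    have "\<bar>r x - 1\<bar> powr p \<le> 2 powr p * (r x powr p + 1)" for x
    proof -
      have "\<bar>r x - 1\<bar> powr p \<le> (2 * max (r x) 1) powr p"
        using r0[of x] p by (intro powr_mono2) auto
      also have "\<dots> = 2 powr p * (max (r x) 1) powr p"
        using r0[of x] by (simp add: powr_mult)
      also have "max (r x) 1 powr p \<le> r x powr p + 1"
        by (auto simp: max_def)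
      finally show ?thesis by simp
    qed
    then show "AE x in std_normal_distribution. norm (\<bar>r x - 1\<bar> powr p) \<le> norm (2 powr p * (r x powr p + 1))"
      by (auto simp: abs_mult)
  qed measurable
  have eq: "\<bar>mixture_ratio \<epsilon> \<sigma> x - 1\<bar> powr p = \<bar>r x - 1\<bar> powr p * \<epsilon> powr p" if "0 \<le> \<epsilon>" for \<epsilon> x
  proof -
    have "mixture_ratio \<epsilon> \<sigma> x - 1 = (r x - 1) * \<epsilon>"
      using normal_density_pos[of 1 0 x] by (simp add: mixture_density_def r_def field_simps)
    with that show ?thesis by (simp add: abs_mult powr_mult)
  qed
  show thesis
    by (rule that[of "\<integral>x. \<bar>r x - 1\<bar> powr p \<partial>std_normal_distribution"]) (use int eq in auto)
qed

section \<open>Powerlessness below the detection boundary\<close>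

theorem theorem3:
  fixes \<beta> \<sigma> :: real and \<epsilon> :: "nat \<Rightarrow> real"
  assumes "0 < \<beta>" "\<beta> < 1" "0 < \<sigma>"
    and "\<And>n. \<epsilon> n = real n powr (- \<beta>)"
    and "\<beta> > 1 / 2"
    and "\<sigma> < 1 / sqrt (1 - \<beta>)"
  shows "asymptotically_powerless \<epsilon> \<sigma> (\<lambda>n. lr_test n (\<epsilon> n) \<sigma>) \<and>
    (\<forall>\<phi>. (\<forall>n. is_test n (\<phi> n)) \<longrightarrow> asymptotically_powerless \<epsilon> \<sigma> \<phi>)"
proof -
  \<comment> \<open>An exponent with \<open>p \<beta> > 1\<close>, \<open>p (1 - 1 / \<sigma>\<^sup>2) < 1\<close> and \<open>p \<le> 2\<close>. The maximum with
    \<open>1 / 2\<close> encodes the last bound and keeps the denominator positive for \<open>\<sigma> \<le> 1\<close>.\<close>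
  have "\<sigma>\<^sup>2 < (1 / sqrt (1 - \<beta>))\<^sup>2"
    using assms by (intro power_strict_mono) auto
  then have "1 - 1 / \<sigma>\<^sup>2 < \<beta>"
    using assms by (simp add: power_divide field_simps)
  with assms have "1 / \<beta> < 1 / max (1 - 1 / \<sigma>\<^sup>2) (1 / 2)"
    by (intro divide_strict_left_mono) auto
  then obtain p where p: "1 / \<beta> < p" "p < 1 / max (1 - 1 / \<sigma>\<^sup>2) (1 / 2)"
    using dense by blast
  have p\<beta>: "1 < p * \<beta>" using p(1) assms by (simp add: field_simps)
  have "1 < 1 / \<beta>" using assms by simp
  with p have p1: "1 < p" by simp
  have pmax: "p * max (1 - 1 / \<sigma>\<^sup>2) (1 / 2) < 1"
    using p(2) by (subst (asm) pos_less_divide_eq) auto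
  have "p * (1 / 2) \<le> p * max (1 - 1 / \<sigma>\<^sup>2) (1 / 2)" "p * (1 - 1 / \<sigma>\<^sup>2) \<le> p * max (1 - 1 / \<sigma>\<^sup>2) (1 / 2)"
    using p1 by (intro mult_left_mono; simp)+
  with pmax have p2: "p \<le> 2" and pw: "p * (1 - 1 / \<sigma>\<^sup>2) < 1" by auto
  obtain C where C:
      "\<And>\<epsilon>. 0 \<le> \<epsilon> \<Longrightarrow> integrable std_normal_distribution (\<lambda>x. \<bar>mixture_ratio \<epsilon> \<sigma> x - 1\<bar> powr p)"
      "\<And>\<epsilon>. 0 \<le> \<epsilon> \<Longrightarrow> (\<integral>x. \<bar>mixture_ratio \<epsilon> \<sigma> x - 1\<bar> powr p \<partial>std_normal_distribution) = C * \<epsilon> powr p"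
  proof -
    have "0 \<le> p" using p1 by simp
    from mixture_ratio_moment[OF \<open>0 < \<sigma>\<close> this pw] that show thesis by blast
  qed
  \<comment> \<open>The square root of the rate \<open>n (\<epsilon> n) powr p\<close> balances the two terms of
    \<open>total_variation_PiM_le\<close>.\<close>
  define c where "c n = real n powr ((1 - p * \<beta>) / 2)" for n :: nat
  have c_lim: "c \<longlonglongrightarrow> 0"
    unfolding c_def using p\<beta>
    by (intro tendsto_neg_powr filterlim_real_sequentially) auto
  have bound: "1 - (C / 2 + 2) * c n \<le> risk n (\<epsilon> n) \<sigma> \<phi>" if "is_test n \<phi>" "n \<ge> 1" for n \<phi>
  proof -
    interpret prob_space std_normal_distribution by (rule prob_space_std_normal)
    have n: "1 \<le> real n" using that by simp
    have \<epsilon>: "0 \<le> \<epsilon> n" "\<epsilon> n \<le> 1"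
      using powr_mono[of "-\<beta>" 0 "real n"] n assms(1,4) by auto
    have c: "0 < c n" using n by (simp add: c_def)
    have "real n * \<epsilon> n powr p = real n powr 1 * real n powr (- (p * \<beta>))"
      using n by (simp add: assms(4) powr_powr mult.commute)
    also have "\<dots> = real n powr (1 - p * \<beta>)"
      unfolding powr_add[symmetric] by simp
    also have "\<dots> = c n * c n"
      by (simp add: c_def flip: powr_add)
    finally have rate: "real n * \<epsilon> n powr p = c n * c n" .
    have "(\<integral>x. \<bar>likelihood_ratio n (\<epsilon> n) \<sigma> x - 1\<bar> \<partial>null_law n) \<le>
        real (card {1..n}) * (\<integral>x. \<bar>mixture_ratio (\<epsilon> n) \<sigma> x - 1\<bar> powr p \<partial>std_normal_distribution) / (2 * c n) + 2 * c n"
      unfolding null_law_def likelihood_ratio_def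
      using \<epsilon> p1 p2 \<open>0 < \<sigma>\<close> c C(1) mixture_ratio_mean_one
      by (intro total_variation_PiM_le) (auto simp: mixture_density_nonneg)
    also have "\<dots> = C * (real n * \<epsilon> n powr p) / (2 * c n) + 2 * c n"
      using C(2) \<epsilon> by simp
    also have "\<dots> = (C / 2 + 2) * c n"
      unfolding rate using c by (simp add: field_simps)
    finally show ?thesis
      using risk_ge_total_variation[OF \<epsilon> \<open>0 < \<sigma>\<close> that(1)] by simp
  qed
  have *: "asymptotically_powerless \<epsilon> \<sigma> \<phi>" if \<phi>: "\<And>n. is_test n (\<phi> n)" for \<phi>
  proof -
    have "(\<lambda>n. 1 - (C / 2 + 2) * c n) \<longlonglongrightarrow> 1 - (C / 2 + 2) * 0"
      by (intro tendsto_intros c_lim)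
    then have "(\<lambda>n. ereal (1 - (C / 2 + 2) * c n)) \<longlonglongrightarrow> 1"
      by (simp add: one_ereal_def)
    then have "1 = liminf (\<lambda>n. ereal (1 - (C / 2 + 2) * c n))"
      by (intro lim_imp_Liminf[symmetric]) auto
    also have "\<dots> \<le> liminf (\<lambda>n. ereal (risk n (\<epsilon> n) \<sigma> (\<phi> n)))"
      using bound[OF \<phi>] by (intro Liminf_mono) (auto simp: eventually_sequentially)
    finally show ?thesis by (simp add: asymptotically_powerless_def)
  qed
  show ?thesis
    by (intro conjI allI impI *) (simp_all add: is_test_lr_test)
qed

end
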